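(* Every graph $G$ has a $(\leq 3\cdot 2^{2|E(G)|-1})$-subdivision $S$ with $\phi(S)\le 14$.
   Context: An anagram is a word of the form $WP$ where $W$ is a non-empty word and $P$ is a permutation of $W$. A vertex colouring of a graph is anagram-free if the sequence of colours along every path of the graph is not an anagram. $\phi(G)$ is the minimum number of colours in an anagram-free colouring of $G$. A subdivision of $G$ is obtained by replacing each edge $uv$ by a path with endpoints $u,v$; internal vertices are division vertices. A $(\le k)$-subdivision is a subdivision in which every edge receives at most $k$ division vertices. *)

theory Defs
  imports "HOL-Library.Multiset" "Graph_Theory.Pair_Digraph" "Graph_Theory.Vertex_Walk"
begin

text \<open>
  A finite simple undirected graph is a \<open>pair_graph\<close>: each undirected edge \<open>uv\<close> is stored as
  the two arcs \<open>(u, v)\<close> and \<open>(v, u)\<close>, so edges are counted as two-element sets.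
\<close>

definition uedges :: "'a pair_pre_digraph \<Rightarrow> 'a set set" where
  "uedges G = (\<lambda>(u, v). {u, v}) ` parcs G"


definition anagram :: "'c list \<Rightarrow> bool" where
  "anagram xs \<longleftrightarrow> (\<exists>W P. xs = W @ P \<and> W \<noteq> [] \<and> mset P = mset W)"

definition anagram_free_colouring :: "'a pair_pre_digraph \<Rightarrow> ('a \<Rightarrow> 'c) \<Rightarrow> bool" where
  "anagram_free_colouring G c \<longleftrightarrow> (\<forall>p. vpath p (with_proj G) \<longrightarrow> \<not> anagram (map c p))"

definition anagram_free_chromatic_number :: "'a pair_pre_digraph \<Rightarrow> nat" (\<open>\<phi>\<close>) where
  "\<phi> G = (LEAST n. \<exists>c :: 'a \<Rightarrow> nat. c ` pverts G \<subseteq> {..<n} \<and> anagram_free_colouring G c)"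

text \<open>For a finite vertex set the minimum exists: an injective colouring is anagram-free.\<close>

lemma anagram_free_colouring_exists:
  fixes G :: "'a pair_pre_digraph"
  assumes "finite (pverts G)"
  shows "\<exists>n. \<exists>c :: 'a \<Rightarrow> nat. c ` pverts G \<subseteq> {..<n} \<and> anagram_free_colouring G c"
proof -
  obtain c :: "'a \<Rightarrow> nat" where inj: "inj_on c (pverts G)"
    using assms finite_imp_inj_to_nat_seg by metis
  obtain n where n: "c ` pverts G \<subseteq> {..<n}"
    using assms by (meson finite_imageI finite_nat_iff_bounded)
  have "\<not> anagram (map c p)" if "vpath p (with_proj G)" for p
  proof
    assume "anagram (map c p)"
    then obtain W P where WP: "map c p = W @ P" "W \<noteq> []" "mset P = mset W"
      by (auto simp: anagram_def)
    have "distinct p" "set p \<subseteq> pverts G"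
      using that by (auto simp: vpath_def vwalk_def)
    then have "distinct (map c p)"
      using inj by (auto simp: distinct_map intro: inj_on_subset)
    moreover have "set P = set W"
      using WP(3) by (rule mset_eq_setD)
    ultimately show False
      using WP by auto
  qed
  then show ?thesis
    using n by (auto simp: anagram_free_colouring_def)
qed


definition internal_verts :: "'a list \<Rightarrow> 'a list" where
  "internal_verts p = butlast (tl p)"

text \<open>
  \<open>S\<close> arises from \<open>G\<close> by replacing every edge \<open>uv\<close> with the path \<open>P (u, v)\<close>.  The vertices of
  \<open>S\<close> may live in a different type than those of \<open>G\<close> (which could have too few elements for the
  division vertices), hence the injection \<open>f\<close>.  Since \<open>uv\<close> appears as two arcs, \<open>P (v, u)\<close> has to
  be the same path traversed backwards.
\<close>

definition subdivision_by ::
  "'a pair_pre_digraph \<Rightarrow> 'b pair_pre_digraph \<Rightarrow> ('a \<Rightarrow> 'b) \<Rightarrow> ('a \<times> 'a \<Rightarrow> 'b list) \<Rightarrow> bool" where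
  "subdivision_by G S f P \<longleftrightarrow>
     pair_graph S \<and>
     inj_on f (pverts G) \<and>
     (\<forall>(u, v) \<in> parcs G.
        vpath (P (u, v)) (with_proj S) \<and>
        hd (P (u, v)) = f u \<and> last (P (u, v)) = f v \<and>
        P (v, u) = rev (P (u, v)) \<and>
        set (internal_verts (P (u, v))) \<inter> f ` pverts G = {}) \<and>
     (\<forall>(u, v) \<in> parcs G. \<forall>(x, y) \<in> parcs G. {u, v} \<noteq> {x, y} \<longrightarrow>
        set (internal_verts (P (u, v))) \<inter> set (internal_verts (P (x, y))) = {}) \<and>
     pverts S = f ` pverts G \<union> (\<Union>a \<in> parcs G. set (P a)) \<and>
     parcs S = (\<Union>a \<in> parcs G. set (vwalk_arcs (P a)))"

definition le_subdivision :: "nat \<Rightarrow> 'a pair_pre_digraph \<Rightarrow> 'b pair_pre_digraph \<Rightarrow> bool" where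
  "le_subdivision k G S \<longleftrightarrow>
     (\<exists>f P. subdivision_by G S f P \<and> (\<forall>a \<in> parcs G. length (internal_verts (P a)) \<le> k))"

text \<open>
  If \<open>G\<close> has no edges, truncated subtraction makes the exponent \<open>2 * card (uedges G) - 1\<close> equal
  to 0 rather than -1; this is harmless because the bound then constrains no edge.
\<close>

end

theory Submission
  imports Defs "HOL-Library.Sublist" "HOL-Library.Nat_Bijection"
begin

text \<open>
  The substitution \<open>a \<mapsto> a (a+3) (a+5) (a+7) a\<close> on the letters modulo 8 preserves
  anagram-freeness, so there are arbitrarily long anagram-free words on 8 letters. Number the edges
  \<open>0, \<dots>, m - 1\<close>. Edge \<open>i\<close> is subdivided and coloured by such a word, interleaved with \<open>2\<^sup>i\<close> copies
  of each of four marker colours, the markers appearing in increasing order; all original vertices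
  share one further colour. (Edge 0 gets just the four markers, for the sake of the length bound.)

  Suppose a path is coloured by an anagram \<open>W P\<close>. Along the subdivided edges, membership in \<open>W\<close>, in
  \<open>P\<close> or in neither changes at no more than three places: the middle and the two ends of the path.
  Hence some marker \<open>q\<close> is such that on every edge either all or none of the \<open>q\<close>-vertices lie in \<open>W\<close>,
  and likewise for \<open>P\<close>. Counting \<open>q\<close> in \<open>W\<close> and \<open>P\<close> gives two equal sums of powers of two over
  disjoint sets of edges, so \<open>q\<close> does not occur at all. Then the path cannot traverse a whole edge
  and meets at most one original vertex, hence none because original vertices occur equally often in
  \<open>W\<close> and \<open>P\<close>. So the path lies inside a single edge, whose word is anagram-free.
\<close>

section \<open>Anagram-free words\<close>

definition anagram_free :: "'c list \<Rightarrow> bool" where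
  "anagram_free w \<longleftrightarrow> (\<forall>x. sublist x w \<longrightarrow> \<not> anagram x)"

lemma anagram_free_sublist: "anagram_free w \<Longrightarrow> sublist x w \<Longrightarrow> anagram_free x"
  by (meson anagram_free_def sublist_order.order_trans)

text \<open>Cutting before \<open>W\<close>, between \<open>W\<close> and \<open>P\<close> and after
  \<open>P\<close> yields three prefixes whose letter counts form an arithmetic progression, so that
  anagrams become a matter of counting in prefixes. The prefixes come in order, up to exchanging
  \<open>y1\<close> and \<open>y3\<close>, because their lengths form a progression too.\<close>

lemma anagram_free_iff_prefixes:
  "anagram_free w \<longleftrightarrow>
     (\<forall>y1 y2 y3. prefix y1 w \<and> prefix y2 w \<and> prefix y3 w \<and>
        mset y1 + mset y3 = mset y2 + mset y2 \<longrightarrow> y1 = y2)"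
proof
  assume af: "anagram_free w"
  have less: "y1 = y2"
    if p: "prefix y2 w" "prefix y3 w" and eq: "mset y1 + mset y3 = mset y2 + mset y2"
      and "prefix y1 y2" for y1 y2 y3
  proof (rule ccontr)
    assume "y1 \<noteq> y2"
    with \<open>prefix y1 y2\<close> obtain W where W: "y2 = y1 @ W" "W \<noteq> []"
      by (auto simp: prefix_def)
    have "length y1 + length y3 = length y2 + length y2"
      using arg_cong[OF eq, of size] by simp
    then have "prefix y2 y3"
      using p W by (metis add_le_cancel_right le_add1 length_append nat_le_linear prefix_length_prefix
        add_le_cancel_left)
    then obtain P where P: "y3 = y2 @ P"
      by (auto simp: prefix_def)
    have "mset P = mset W"
      using eq unfolding P W by simp
    moreover have "sublist (W @ P) w"
      using p P W by (metis append.assoc prefix_def sublist_appendI)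
    ultimately show False
      using af W by (auto simp: anagram_free_def anagram_def)
  qed
  show "\<forall>y1 y2 y3. prefix y1 w \<and> prefix y2 w \<and> prefix y3 w \<and>
        mset y1 + mset y3 = mset y2 + mset y2 \<longrightarrow> y1 = y2"
  proof (intro allI impI, elim conjE)
    fix y1 y2 y3
    assume p: "prefix y1 w" "prefix y2 w" "prefix y3 w" and eq: "mset y1 + mset y3 = mset y2 + mset y2"
    have len: "length y1 + length y3 = length y2 + length y2"
      using arg_cong[OF eq, of size] by simp
    show "y1 = y2"
    proof (cases "length y1 \<le> length y2")
      case True
      then show ?thesis using less p eq prefix_length_prefix by blast
    next
      case False
      then have "prefix y3 y2"
        using p len by (metis add_le_cancel_right nat_le_linear prefix_length_prefix
          add_le_mono)
      then have "y3 = y2"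
        using less[of y2 y1 y3] p eq by (simp add: add.commute)
      with len False show ?thesis by simp
    qed
  qed
next
  assume *: "\<forall>y1 y2 y3. prefix y1 w \<and> prefix y2 w \<and> prefix y3 w \<and>
        mset y1 + mset y3 = mset y2 + mset y2 \<longrightarrow> y1 = y2"
  have False if "w = u @ (W @ P) @ v" "W \<noteq> []" "mset P = mset W" for u v W P
    using *[rule_format, of u "u @ W" "u @ W @ P"] that by simp
  then show "anagram_free w"
    unfolding anagram_free_def anagram_def sublist_def by blast
qed

section \<open>Anagrams under letter maps, reversal and deletion of letters\<close>

lemma anagram_mapD:
  assumes "anagram (map f w)"
  obtains W P where "w = W @ P" "W \<noteq> []" "P \<noteq> []" "mset (map f W) = mset (map f P)"
proof -
  from assms obtain W' P' where 1: "map f w = W' @ P'" "W' \<noteq> []" "mset P' = mset W'"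
    by (auto simp: anagram_def)
  from 1(1) obtain W P where 2: "w = W @ P" "map f W = W'" "map f P = P'"
    by (auto simp: map_eq_append_conv)
  show thesis
    by (rule that[OF 2(1)]) (use 1 2 in auto)
qed

lemma anagram_map: "anagram w \<Longrightarrow> anagram (map f w)"
  unfolding anagram_def by (metis map_append mset_map map_is_Nil_conv)

lemma anagram_map_inj:
  assumes "inj_on f (set w)" "anagram (map f w)"
  shows "anagram w"
proof -
  have "map (the_inv_into (set w) f) (map f w) = w"
    using assms(1) by (simp add: map_idI the_inv_into_f_f)
  then show ?thesis
    using anagram_map[OF assms(2)] by metis
qed

lemma anagram_rev: "anagram (rev w) \<longleftrightarrow> anagram w"
proof -
  have "anagram (rev w)" if "anagram w" for w :: "'c list"
  proof -
    from that obtain W P where "w = W @ P" "W \<noteq> []" "mset P = mset W"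
      by (auto simp: anagram_def)
    then show ?thesis
      unfolding anagram_def by (intro exI[of _ "rev P"] exI[of _ "rev W"]) auto
  qed
  from this[of w] this[of "rev w"] show ?thesis by auto
qed

lemma anagram_free_map_inj:
  assumes "inj_on f (set w)" "anagram_free w"
  shows "anagram_free (map f w)"
  unfolding anagram_free_def
proof (intro allI impI notI)
  fix x assume "sublist x (map f w)" "anagram x"
  then obtain y where "sublist y w" "x = map f y"
    by (metis sublist_map_rightE)
  then show False
    using assms \<open>anagram x\<close> anagram_map_inj[of f y]
    by (meson anagram_free_def inj_on_subset set_mono_sublist)
qed

lemma distinct_anagram_free:
  assumes "distinct w"
  shows "anagram_free w"
proof -
  have False if "w = u @ (W @ P) @ v" "W \<noteq> []" "mset P = mset W" for u v W P
    using assms that mset_eq_setD[OF that(3)] by auto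
  then show ?thesis
    unfolding anagram_free_def anagram_def sublist_def by blast
qed

text \<open>Deleting the letters violating \<open>Q\<close> keeps an anagram an anagram, unless it consists of such letters
  only, which is impossible if they are isolated.\<close>

lemma anagram_free_filter:
  assumes af: "anagram_free (filter Q w)"
    and isolated: "successively (\<lambda>a b. Q a \<or> Q b) w"
  shows "anagram_free w"
proof -
  have False if w: "w = u @ (W @ P) @ v" "W \<noteq> []" "mset P = mset W" for u v W P
  proof -
    have eq: "mset (filter Q P) = mset (filter Q W)"
      using w(3) by simp
    have "sublist (filter Q W @ filter Q P) (filter Q w)"
      unfolding w(1) by (simp add: sublist_def) (metis append.assoc)
    then have "filter Q W = []"
      using af eq unfolding anagram_free_def anagram_def by blast
    moreover from this have "filter Q P = []"
      using eq by simp
    moreover have "P \<noteq> []"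
      using w by auto
    ultimately have "\<not> Q (last W)" "\<not> Q (hd P)"
      using w(2) by (auto simp: filter_empty_conv)
    then show False
      using isolated w \<open>P \<noteq> []\<close> by (auto simp: successively_append_iff)
  qed
  then show ?thesis
    unfolding anagram_free_def anagram_def sublist_def by blast
qed

section \<open>A substitution preserving anagram-freeness\<close>

definition \<theta> :: "nat \<Rightarrow> nat list" where
  "\<theta> a = [a, (a + 3) mod 8, (a + 5) mod 8, (a + 7) mod 8, a]"

definition subst_word :: "nat list \<Rightarrow> nat list" where
  "subst_word w = concat (map \<theta> w)"

lemma subst_word_simps [simp]:
  "subst_word [] = []" "subst_word (a # w) = \<theta> a @ subst_word w"
  "subst_word (v @ w) = subst_word v @ subst_word w"
  by (simp_all add: subst_word_def)

lemma length_theta [simp]: "length (\<theta> a) = 5"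
  by (simp add: \<theta>_def)

lemma length_subst_word [simp]: "length (subst_word w) = 5 * length w"
  by (induction w) auto

lemma set_subst_word: "set w \<subseteq> {..<8} \<Longrightarrow> set (subst_word w) \<subseteq> {..<8}"
  by (induction w) (auto simp: \<theta>_def)

lemma less_8_cases: "a < 8 \<Longrightarrow> a \<in> {0, 1, 2, 3, 4, 5, 6, 7::nat}"
  by auto

text \<open>Since \<open>2 + 2\<^sup>3 + 2\<^sup>5 + 2\<^sup>7 = 2 \<cdot> 85\<close> and \<open>2\<^sup>8 \<equiv> 1 (mod 85)\<close>, every block \<open>\<theta> a\<close> has weight 0
  modulo 85.\<close>

definition weight :: "nat list \<Rightarrow> int" where
  "weight w = (\<Sum>a\<leftarrow>w. 2 ^ a)"

lemma weight_append [simp]: "weight (v @ w) = weight v + weight w"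
  by (simp add: weight_def)

lemma weight_theta: "a < 8 \<Longrightarrow> 85 dvd weight (\<theta> a)"
  by (drule less_8_cases) (auto simp: weight_def \<theta>_def)

lemma weight_subst_word: "set w \<subseteq> {..<8} \<Longrightarrow> 85 dvd weight (subst_word w)"
proof (induction w)
  case Nil
  then show ?case by (simp add: weight_def)
qed (auto simp: weight_theta)

text \<open>Entries \<open>(i, a, x)\<close>, where \<open>x\<close> is the weight modulo 85 of the prefix of \<open>\<theta> a\<close> of length \<open>i\<close>. For
  \<open>i = 0\<close> the letter is irrelevant and set to 0.\<close>

definition cuts :: "(int \<times> int \<times> int) list" where
  "cuts =
     [(0, 0, 0), (1, 0, 1), (1, 1, 2), (1, 2, 4), (1, 3, 8), (1, 4, 16), (1, 5, 32), (1, 6, 64),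
      (1, 7, 43), (2, 0, 9), (2, 1, 18), (2, 2, 36), (2, 3, 72), (2, 4, 59), (2, 5, 33),
      (2, 6, 66), (2, 7, 47), (3, 0, 41), (3, 1, 82), (3, 2, 79), (3, 3, 73), (3, 4, 61),
      (3, 5, 37), (3, 6, 74), (3, 7, 63), (4, 0, 84), (4, 1, 83), (4, 2, 81), (4, 3, 77),
      (4, 4, 69), (4, 5, 53), (4, 6, 21), (4, 7, 42)]"

lemma weight_in_cuts:
  assumes "i < 5" "a < 8"
  shows "(int i, if i = 0 then 0 else int a, weight (take i (\<theta> a)) mod 85) \<in> set cuts"
proof -
  have "i \<in> {0, 1, 2, 3, 4}"
    using assms(1) by auto
  with less_8_cases[OF assms(2)] show ?thesis
    unfolding weight_def cuts_def \<theta>_def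
    by (elim insertE emptyE; hypsubst; code_simp)
qed

text \<open>All 33^3 triples are checked by evaluation. The exceptional alternative stems from the
  letter \<open>a\<close> at both ends of \<open>\<theta> a\<close>: since the block has weight 0
  modulo 85, the cuts after one and after four letters have opposite weights and balance around a
  block boundary.\<close>

lemma cuts_progression_free:
  "\<forall>(i, a, x) \<in> set cuts. \<forall>(j, b, y) \<in> set cuts. \<forall>(k, c, z) \<in> set cuts.
     (i + k) mod 5 = (j + j) mod 5 \<longrightarrow> (x + z) mod 85 = (y + y) mod 85 \<longrightarrow>
     i = j \<and> j = k \<and> (i = 0 \<or> a = b \<and> b = c) \<or>
     j = 0 \<and> a = c \<and> (i = 1 \<and> k = 4 \<or> i = 4 \<and> k = 1)"
  unfolding cuts_def by code_simp

lemma cuts_progression_freeD: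
  assumes "(i, a, x) \<in> set cuts" "(j, b, y) \<in> set cuts" "(k, c, z) \<in> set cuts"
    and "(i + k) mod 5 = (j + j) mod 5" "(x + z) mod 85 = (y + y) mod 85"
  shows "i = j \<and> j = k \<and> (i = 0 \<or> a = b \<and> b = c) \<or>
     j = 0 \<and> a = c \<and> (i = 1 \<and> k = 4 \<or> i = 4 \<and> k = 1)"
  using cuts_progression_free[THEN bspec, OF assms(1), unfolded prod.case, THEN bspec, OF assms(2),
      unfolded prod.case, THEN bspec, OF assms(3), unfolded prod.case] assms(4,5) by blast

section \<open>Letter counts under the substitution\<close>

text \<open>The shifts 5, 3, 1 are the negatives of 3, 5, 7 modulo 8, as the formula asks which
  blocks contain a given letter.\<close>

lemma count_subst_word:
  assumes "set w \<subseteq> {..<8}" "l < 8"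
  shows "count (mset (subst_word w)) l = 2 * count (mset w) l + count (mset w) ((l + 5) mod 8) +
    count (mset w) ((l + 3) mod 8) + count (mset w) ((l + 1) mod 8)"
  using assms(1)
proof (induction w)
  case (Cons a w)
  then have "a \<in> {0, 1, 2, 3, 4, 5, 6, 7}"
    using less_8_cases by auto
  with less_8_cases[OF assms(2)]
  have "count (mset (\<theta> a)) l = 2 * (if a = l then 1 else 0) + (if a = (l + 5) mod 8 then 1 else 0) +
      (if a = (l + 3) mod 8 then 1 else 0) + (if a = (l + 1) mod 8 then 1 else 0)"
    by (elim insertE emptyE; simp add: \<theta>_def)
  with Cons show ?case by simp
qed simp

text \<open>The substitution acts on letter counts by a circulant 8 by 8 matrix that is invertible
  over the rationals, so a linear relation between the counts of the images can be pulled
  back.\<close>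

lemma subst_word_inj_mset:
  assumes w: "set w1 \<subseteq> {..<8}" "set w2 \<subseteq> {..<8}" "set w3 \<subseteq> {..<8}"
    and eq: "mset (subst_word w1) + mset (subst_word w3) = mset (subst_word w2) + mset (subst_word w2)"
  shows "mset w1 + mset w3 = mset w2 + mset w2"
proof (rule multiset_eqI)
  fix l
  \<comment> \<open>\<open>d\<close> measures how far the counts of each letter are from a
    progression; the equations \<open>e\<close> below say that the circulant matrix annihilates
    it.\<close>
  define d where "d l = int (count (mset w1) l) + int (count (mset w3) l) - 2 * int (count (mset w2) l)" for l
  have eqs: "2 * d l + d ((l + 5) mod 8) + d ((l + 3) mod 8) + d ((l + 1) mod 8) = 0" if "l < 8" for l
    using arg_cong[OF eq, of "\<lambda>M. int (count M l)"] that
    unfolding plus_multiset.rep_eq count_subst_word[OF w(1) that] count_subst_word[OF w(2) that]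
      count_subst_word[OF w(3) that] d_def by simp
  have e: "2 * d 0 + d 5 + d 3 + d 1 = 0" "2 * d 1 + d 6 + d 4 + d 2 = 0"
    "2 * d 2 + d 7 + d 5 + d 3 = 0" "2 * d 3 + d 0 + d 6 + d 4 = 0"
    "2 * d 4 + d 1 + d 7 + d 5 = 0" "2 * d 5 + d 2 + d 0 + d 6 = 0"
    "2 * d 6 + d 3 + d 1 + d 7 = 0" "2 * d 7 + d 4 + d 2 + d 0 = 0"
    subgoal using eqs[of 0] by simp
    subgoal using eqs[of 1] by (simp flip: numeral_2_eq_2)
    subgoal using eqs[of 2] by simp
    subgoal using eqs[of 3] by simp
    subgoal using eqs[of 4] by simp
    subgoal using eqs[of 5] by simp
    subgoal using eqs[of 6] by simp
    subgoal using eqs[of 7] by simp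
    done
  show "count (mset w1 + mset w3) l = count (mset w2 + mset w2) l"
  proof (cases "l < 8")
    case True
    have "d l = 0"
      using less_8_cases[OF True] e by (elim insertE emptyE; hypsubst; linarith)
    then show ?thesis
      by (simp add: d_def)
  next
    case False
    then have "count (mset w1) l = 0" "count (mset w2) l = 0" "count (mset w3) l = 0"
      using w by (auto simp: count_mset_0_iff)
    then show ?thesis by (simp only: plus_multiset.rep_eq)
  qed
qed

text \<open>A cut at the end of a block is recorded as \<open>i = 0\<close> with that block already
  in \<open>y\<close>, whence \<open>i < 5\<close>. There may be no following letter then;
  \<open>a\<close> falls back to 0, which is a legal letter and agrees with the entry for
  \<open>i = 0\<close> in \<open>cuts\<close>.\<close>

lemma prefix_subst_wordE:
  assumes "prefix x (subst_word w)"
  obtains y i a where "x = subst_word y @ take i (\<theta> a)" "i < 5" "prefix y w"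
    "i = 0 \<and> a = 0 \<or> prefix (y @ [a]) w"
proof -
  have "\<exists>y i a. x = subst_word y @ take i (\<theta> a) \<and> i < 5 \<and> prefix y w \<and>
      (i = 0 \<and> a = 0 \<or> prefix (y @ [a]) w)"
    using assms
  proof (induction w rule: rev_induct)
    case Nil
    then show ?case by (intro exI[of _ "[]"] exI[of _ 0]) auto
  next
    case (snoc b w)
    consider "prefix x (subst_word w)" | "x = subst_word (w @ [b])"
      | p where "x = subst_word w @ p" "prefix p (\<theta> b)" "p \<noteq> \<theta> b"
      using snoc.prems by (auto simp: prefix_append)
    then show ?case
    proof cases
      case 1
      then show ?thesis using snoc.IH by (meson prefix_prefix)
    next
      case 2
      then show ?thesis by (intro exI[of _ "w @ [b]"] exI[of _ 0]) auto
    next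
      case 3
      then obtain q where q: "\<theta> b = p @ q" "q \<noteq> []"
        by (auto simp: prefix_def)
      then have "length p < 5"
        using length_theta[of b] by (metis length_append length_greater_0_conv less_add_same_cancel1)
      moreover have "x = subst_word w @ take (length p) (\<theta> b)" "prefix (w @ [b]) (w @ [b])" "prefix w (w @ [b])"
        using 3(1) q(1) by simp_all
      ultimately show ?thesis by blast
    qed
  qed
  then show thesis using that by blast
qed

text \<open>The three cuts that delimit an anagram in \<open>subst_word w\<close> are in arithmetic progression with respect
  to length modulo 5 and weight modulo 85. So either they cut their blocks in the same way, or the
  middle one falls between two blocks and the outer ones split two copies of the same block into
  complementary parts. In both cases they can be moved to block boundaries.\<close>

theorem anagram_free_subst_word:
  assumes w: "set w \<subseteq> {..<8}" and af: "anagram_free w"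
  shows "anagram_free (subst_word w)"
  unfolding anagram_free_iff_prefixes
proof (intro allI impI, elim conjE)
  fix x1 x2 x3
  assume p: "prefix x1 (subst_word w)" "prefix x2 (subst_word w)" "prefix x3 (subst_word w)"
    and eq: "mset x1 + mset x3 = mset x2 + mset x2"
  have prefix_less: "set y \<subseteq> {..<8}" if "prefix y w" for y
    using set_mono_prefix[OF that] w by auto
  have af': "y1 = y2 \<and> y2 = y3"
    if "prefix y1 w" "prefix y2 w" "prefix y3 w"
      "mset (subst_word y1) + mset (subst_word y3) = mset (subst_word y2) + mset (subst_word y2)"
    for y1 y2 y3
  proof -
    have *: "mset y1 + mset y3 = mset y2 + mset y2"
      by (rule subst_word_inj_mset[OF prefix_less prefix_less prefix_less that(4)]) fact+
    then show ?thesis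
      using af[unfolded anagram_free_iff_prefixes, rule_format, of y1 y2 y3]
        af[unfolded anagram_free_iff_prefixes, rule_format, of y3 y2 y1] that by (simp add: add.commute)
  qed
  obtain y1 i a where 1: "x1 = subst_word y1 @ take i (\<theta> a)" "i < 5" "prefix y1 w"
      "i = 0 \<and> a = 0 \<or> prefix (y1 @ [a]) w"
    using p(1) by (rule prefix_subst_wordE)
  obtain y2 j b where 2: "x2 = subst_word y2 @ take j (\<theta> b)" "j < 5" "prefix y2 w"
      "j = 0 \<and> b = 0 \<or> prefix (y2 @ [b]) w"
    using p(2) by (rule prefix_subst_wordE)
  obtain y3 k c where 3: "x3 = subst_word y3 @ take k (\<theta> c)" "k < 5" "prefix y3 w"
      "k = 0 \<and> c = 0 \<or> prefix (y3 @ [c]) w"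
    using p(3) by (rule prefix_subst_wordE)
  have snoc_less: "a < 8" if "i = 0 \<and> a = 0 \<or> prefix (y @ [a]) w" for i :: nat and a y
    using that w by (auto simp: prefix_def)
  have less: "set y1 \<subseteq> {..<8}" "set y2 \<subseteq> {..<8}" "set y3 \<subseteq> {..<8}" "a < 8" "b < 8" "c < 8"
    using 1(3) 2(3) 3(3) 1(4)[THEN snoc_less] 2(4)[THEN snoc_less] 3(4)[THEN snoc_less]
    by (simp_all only: prefix_less)
  have "5 * length y1 + i + (5 * length y3 + k) = 5 * length y2 + j + (5 * length y2 + j)"
    using arg_cong[OF eq, of size] 1 2 3 by simp
  then have len: "(int i + int k) mod 5 = (int j + int j) mod 5"
    by presburger
  \<comment> \<open>The weight depends on the multiset only, so it inherits the progression; whole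
    blocks then vanish modulo 85.\<close>
  have "weight x1 + weight x3 = weight x2 + weight x2"
    using arg_cong[OF eq, of "\<lambda>M. \<Sum>a\<in>#M. 2 ^ a :: int"]
    by (simp add: weight_def sum_mset_sum_list[symmetric])
  moreover obtain q1 q2 q3 where "weight (subst_word y1) = 85 * q1" "weight (subst_word y2) = 85 * q2"
      "weight (subst_word y3) = 85 * q3"
    using weight_subst_word[OF less(1)] weight_subst_word[OF less(2)] weight_subst_word[OF less(3)]
    by (elim dvdE)
  ultimately have "weight (take i (\<theta> a)) + weight (take k (\<theta> c)) =
      weight (take j (\<theta> b)) + weight (take j (\<theta> b)) + 85 * (2 * q2 - q1 - q3)"
    unfolding 1(1) 2(1) 3(1) weight_append by simp
  then have wt: "(weight (take i (\<theta> a)) mod 85 + weight (take k (\<theta> c)) mod 85) mod 85 =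
      (weight (take j (\<theta> b)) mod 85 + weight (take j (\<theta> b)) mod 85) mod 85"
    by (simp only: mod_add_eq mod_mult_self2)
  have "i = j \<and> j = k \<and> (i = 0 \<or> a = b \<and> b = c) \<or> j = 0 \<and> a = c \<and> (i = 1 \<and> k = 4 \<or> i = 4 \<and> k = 1)"
    using cuts_progression_freeD[OF weight_in_cuts[OF 1(2) less(4)] weight_in_cuts[OF 2(2) less(5)]
        weight_in_cuts[OF 3(2) less(6)] len wt] 1(4) 3(4)
    by (auto split: if_splits)
  then consider "i = j" "j = k" "i = 0 \<or> a = b \<and> b = c"
    | "j = 0" "a = c" "i = 1 \<and> k = 4 \<or> i = 4 \<and> k = 1"
    by blast
  then show "x1 = x2"
  proof cases
    case same: 1
    then have "take i (\<theta> a) = take j (\<theta> b)" "take k (\<theta> c) = take j (\<theta> b)"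
      by auto
    then show ?thesis
      using af'[OF 1(3) 2(3) 3(3)] eq unfolding 1(1) 2(1) 3(1) by auto
  next
    case exc: 2
    have pre: "prefix (y1 @ [a]) w" "prefix (y3 @ [a]) w"
      using 1(4) 3(4) exc by auto
    \<comment> \<open>One outer cut takes the first letter \<open>a\<close> and the other the first
      four letters; as the fifth letter is again \<open>a\<close>, they add up to a whole block,
      which is credited to \<open>y1\<close>.\<close>
    have "mset (take i (\<theta> a)) + mset (take k (\<theta> a)) = mset (\<theta> a)"
      using exc by (auto simp: \<theta>_def)
    then have "mset (subst_word (y1 @ [a])) + mset (subst_word y3) = mset (subst_word y2) + mset (subst_word y2)"
      using eq exc unfolding 1(1) 2(1) 3(1) by (simp add: ac_simps)
    then have y3: "y3 = y1 @ [a]"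
      using af'[OF pre(1) 2(3) 3(3)] by simp
    \<comment> \<open>The letter after \<open>y3\<close> is \<open>a\<close> as well, so
      \<open>w\<close> contains the anagram \<open>[a, a]\<close>.\<close>
    have "prefix (y1 @ [a] @ [a]) w"
      using pre(2) unfolding y3 by simp
    then have "sublist [a, a] w"
      by (auto simp: prefix_def sublist_def)
    then show ?thesis
      using af unfolding anagram_free_def anagram_def by (metis append_Cons append_Nil list.distinct(1))
  qed
qed

text \<open>Iterating the substitution from a single letter gives words of length
  \<open>5 ^ n\<close>, from which a prefix of length \<open>n\<close> is taken.\<close>

corollary ex_anagram_free:
  obtains w where "anagram_free w" "set w \<subseteq> {..<8::nat}" "length w = n"
proof -
  define v where "v = (subst_word ^^ n) [0]"
  have "anagram_free v \<and> set v \<subseteq> {..<8} \<and> length v = 5 ^ n"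
    unfolding v_def
  proof (induction n)
    case 0
    have "\<not> anagram x" if "sublist x [0::nat]" for x
    proof
      assume "anagram x"
      then obtain W P where "x = W @ P" "W \<noteq> []" "mset P = mset W"
        by (auto simp: anagram_def)
      moreover from this(3) have "length P = length W"
        by (rule mset_eq_length)
      ultimately show False
        using sublist_length_le[OF that] by (cases W) auto
    qed
    then show ?case by (simp add: anagram_free_def)
  next
    case (Suc n)
    then show ?case
      by (auto simp: anagram_free_subst_word dest: set_subst_word)
  qed
  moreover have "n \<le> 5 ^ n"
    by (simp add: less_imp_le_nat power_gt_expt)
  ultimately show thesis
    using that[of "take n v"] anagram_free_sublist[of v "take n v"] set_take_subset[of n v]
    by (auto simp: take_is_prefix)
qed

section \<open>Words with markers\<close>

text \<open>Equal lengths make markers and letters alternate, so no two markers are adjacent and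
  \<open>anagram_free_filter\<close> applies to the deletion of the markers.\<close>

lemma interleave_markers:
  assumes "length M = length s" "set M \<subseteq> {..<4}" "set s \<subseteq> {5..<13::nat}"
  shows "filter (\<lambda>c. c < 4) (splice M s) = M \<and> filter (\<lambda>c. \<not> c < 4) (splice M s) = s \<and>
    set (splice M s) = set M \<union> set s \<and>
    successively (\<lambda>a b. \<not> a < 4 \<or> \<not> b < 4) (splice M s)"
  using assms
proof (induction M s rule: list_induct2)
  case (Cons a M b s)
  then show ?case by (cases M; cases s) (auto simp: successively_Cons)
qed simp

lemma card_nth_eq_count:
  "card {k. k < length xs \<and> xs ! k = c} = count (mset xs) c"
  by (simp add: count_mset count_list_eq_length_filter length_filter_conv_card eq_commute)

lemma ex_edge_word:
  assumes "i < m"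
  obtains w :: "nat list" where "anagram_free w" "set w \<subseteq> {..<13} - {4}"
    "length w \<le> 3 * 2 ^ (2 * m - 1)"
    "\<And>k l. k < l \<Longrightarrow> l < length w \<Longrightarrow> w ! k < 4 \<Longrightarrow> w ! l < 4 \<Longrightarrow> w ! k \<le> w ! l"
    "\<And>q. q < 4 \<Longrightarrow> card {k. k < length w \<and> w ! k = q} = 2 ^ i"
proof -
  define n :: nat where "n = 2 ^ i"
  define M :: "nat list" where "M = replicate n 0 @ replicate n 1 @ replicate n 2 @ replicate n 3"
  have M: "set M \<subseteq> {..<4}" "sorted M" "length M = 4 * n"
    by (auto simp: M_def sorted_append)
  have "\<exists>w. anagram_free w \<and> set w \<subseteq> {..<13} - {4} \<and> length w \<le> 3 * 2 ^ (2 * m - 1) \<and>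
      filter (\<lambda>c. c < 4) w = M"
  \<comment> \<open>For \<open>m = 1\<close> the bound is 6, while four markers interleaved with
    four letters would have length 8. The four markers of edge 0 are distinct and hence anagram-free
    by themselves.\<close>
  proof (cases "i = 0")
    case True
    have "(2::nat) ^ 1 \<le> 2 ^ (2 * m - 1)"
      using assms by (intro power_increasing) auto
    moreover have "filter (\<lambda>c. c < 4) M = M"
      using M by (auto simp: filter_id_conv)
    moreover have "M = [0, 1, 2, 3]"
      using True by (simp add: M_def n_def)
    then have "anagram_free M"
      by (intro distinct_anagram_free) simp
    ultimately show ?thesis
      using M True by (intro exI[of _ M]) (auto simp: n_def)
  next
    case False
    obtain s where s: "anagram_free s" "set s \<subseteq> {..<8::nat}" "length s = 4 * n"
      by (rule ex_anagram_free)
    \<comment> \<open>Shifting by 5 keeps the letters apart from the markers 0 to 3 and from the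
      colour 4 of the original vertices.\<close>
    define t where "t = map (\<lambda>a. a + 5) s"
    have t: "anagram_free t" "set t \<subseteq> {5..<13}" "length t = 4 * n"
      using s unfolding t_def by (auto intro!: anagram_free_map_inj simp: inj_on_def)
    have split: "filter (\<lambda>c. c < 4) (splice M t) = M" "filter (\<lambda>c. \<not> c < 4) (splice M t) = t"
      "set (splice M t) = set M \<union> set t" "successively (\<lambda>a b. \<not> a < 4 \<or> \<not> b < 4) (splice M t)"
      using interleave_markers[of M t] M t by simp_all
    have "anagram_free (splice M t)"
      by (rule anagram_free_filter[of "\<lambda>c. \<not> c < 4"]) (simp_all only: split t)
    moreover have "length (splice M t) \<le> 3 * 2 ^ (2 * m - 1)"
    proof -
      have "length (splice M t) = 2 ^ (i + 3)"
        using M t by (simp add: n_def power_add)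
      \<comment> \<open>From \<open>1 \<le> i\<close> and \<open>i < m\<close> follows
        \<open>i + 3 \<le> 2 * m\<close>.\<close>
      also have "\<dots> \<le> 2 ^ (2 * m - 1 + 1)"
        using False assms by (intro power_increasing) auto
      finally show ?thesis by simp
    qed
    moreover have "set (splice M t) \<subseteq> {..<13} - {4}"
      unfolding split(3) using M(1) t(2) by fastforce
    ultimately show ?thesis
      using split(1) by blast
  qed
  then obtain w where w: "anagram_free w" "set w \<subseteq> {..<13} - {4}" "length w \<le> 3 * 2 ^ (2 * m - 1)"
      "filter (\<lambda>c. c < 4) w = M"
    by blast
  show thesis
  proof (rule that[OF w(1-3)])
    fix k l assume kl: "k < l" "l < length w" "w ! k < 4" "w ! l < 4"
    have "w = take l w @ w ! l # drop (Suc l) w"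
      using kl by (simp add: id_take_nth_drop)
    then have "sorted (filter (\<lambda>c. c < 4) (take l w @ w ! l # drop (Suc l) w))"
      using w(4) M(2) by simp
    moreover have "w ! k \<in> set (take l w)"
      using kl by (auto simp: in_set_conv_nth)
    ultimately show "w ! k \<le> w ! l"
      using kl by (auto simp: sorted_append)
  next
    fix q :: nat assume "q < 4"
    then have "count (mset w) q = count (mset (filter (\<lambda>c. c < 4) w)) q"
      by simp
    also have "\<dots> = n"
      unfolding w(4) using \<open>q < 4\<close> by (auto simp: M_def less_Suc_eq numeral_eq_Suc)
    finally show "card {k. k < length w \<and> w ! k = q} = 2 ^ i"
      by (simp add: card_nth_eq_count n_def)
  qed
qed

section \<open>Paths in the subdivided graph\<close>

text \<open>Turning round would revisit the preceding number, so the direction of the first step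
  persists.\<close>

lemma distinct_unit_steps:
  assumes "distinct ks" "successively (\<lambda>a b. b = Suc a \<or> a = Suc b) ks"
  obtains a b where "ks = [a..<b] \<or> ks = rev [a..<b]"
proof -
  have "\<exists>a b. ks = [a..<b] \<or> ks = rev [a..<b]"
    using assms
  proof (induction ks)
    case Nil
    then show ?case by (intro exI[of _ 0]) simp
  next
    case (Cons x ks)
    show ?case
    proof (cases "ks = []")
      case True
      then show ?thesis by (intro exI[of _ x] exI[of _ "Suc x"]) simp
    next
      case False
      have "\<exists>a b. ks = [a..<b] \<or> ks = rev [a..<b]"
        using Cons.prems False by (intro Cons.IH) (simp_all add: successively_Cons)
      then obtain a b where ab: "ks = [a..<b] \<or> ks = rev [a..<b]"
        by blast
      then have "a < b"
        using False by (metis rev.simps(1) upt_rec)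
      have x: "x \<notin> set ks" "hd ks = Suc x \<or> x = Suc (hd ks)"
        using Cons.prems False by (auto simp: successively_Cons)
      from ab show ?thesis
      proof
        assume ks: "ks = [a..<b]"
        \<comment> \<open>The second alternative is a one-element interval, which has no direction
          yet and becomes a descending run.\<close>
        with \<open>a < b\<close> x consider "a = Suc x" | "x = Suc a" "b = Suc a"
          by force
        then show ?thesis
        proof cases
          case 1
          then have "x # ks = [x..<b]"
            using ks \<open>a < b\<close> by (simp add: upt_conv_Cons)
          then show ?thesis by blast
        next
          case 2
          then have "x # ks = rev [a..<Suc (Suc a)]"
            using ks by simp
          then show ?thesis by blast
        qed
      next
        assume ks: "ks = rev [a..<b]"
        have hd: "hd ks = b - 1"
          using ks \<open>a < b\<close> by (simp add: hd_rev last_upt)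
        with \<open>a < b\<close> x ks consider "x = b" | "b = Suc (Suc x)" "a = Suc x"
          by force
        then show ?thesis
        proof cases
          case 1
          then have "x # ks = rev [a..<Suc b]"
            using ks \<open>a < b\<close> by simp
          then show ?thesis by blast
        next
          case 2
          then have "x # ks = [x..<b]"
            using ks by (simp add: upt_conv_Cons)
          then show ?thesis by blast
        qed
      qed
    qed
  qed
  then show thesis using that by blast
qed

lemma ex_change_between:
  assumes "k < (l :: nat)" "f k \<noteq> f l"
  shows "\<exists>j\<ge>k. j < l \<and> f j \<noteq> f (Suc j)"
proof (rule ccontr)
  assume "\<not> ?thesis"
  then have eq: "f (Suc j) = f j" if "k \<le> j" "j < l" for j
    using that by metis
  have "k \<le> j \<Longrightarrow> j \<le> l \<longrightarrow> f j = f k" for j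
    by (induction rule: dec_induct) (auto simp: eq)
  from this[of l] show False
    using assms by simp
qed

lemma sum_power2_eq_iff:
  assumes "finite I" "finite J"
  shows "(\<Sum>i\<in>I. 2 ^ i :: nat) = (\<Sum>i\<in>J. 2 ^ i) \<longleftrightarrow> I = J"
  using set_encode_eq[OF assms] by (simp add: set_encode_def)

lemma count_map_eq_card:
  assumes "distinct w"
  shows "count (mset (map f w)) c = card {x \<in> set w. f x = c}"
proof -
  have "count (mset (map f w)) c = length (filter (\<lambda>x. f x = c) w)"
    by (induction w) auto
  also have "\<dots> = card {x \<in> set w. f x = c}"
    using assms by (simp flip: distinct_card set_filter)
  finally show ?thesis .
qed

lemma boundary_if_consecutive:
  assumes "W @ P = as @ x # y # bs" "distinct (W @ P)"
    and "(x \<in> set W, x \<in> set P) \<noteq> (y \<in> set W, y \<in> set P)"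
  shows "x = last W \<and> y = hd P"
proof -
  consider us where "as = W @ us" "P = us @ x # y # bs"
    | us where "W = as @ us" "us @ P = x # y # bs"
    using assms(1) by (auto simp: append_eq_append_conv2)
  then show ?thesis
  proof cases
    case 1
    then show ?thesis using assms(2,3) by auto
  next
    case 2
    then consider "us = []" "P = x # y # bs" | "us = [x]" "P = y # bs" | vs where "us = x # y # vs" "bs = vs @ P"
      by (auto simp: append_eq_Cons_conv)
    then show ?thesis
      using 2 assms(2,3) by cases auto
  qed
qed

text \<open>Edge \<open>i\<close> joins \<open>u i\<close> and \<open>v i\<close>, and its division vertices are coloured by the word \<open>E i\<close>.
  Original vertices get colour 4. Colours below 4 are the markers.\<close>

locale subdivision_colouring =
  fixes m :: nat and u v :: "nat \<Rightarrow> 'a" and E :: "nat \<Rightarrow> nat list"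
  assumes anagram_free_E: "i < m \<Longrightarrow> anagram_free (E i)"
    and not_4: "i < m \<Longrightarrow> 4 \<notin> set (E i)"
    and markers_sorted: "i < m \<Longrightarrow> k < l \<Longrightarrow> l < length (E i) \<Longrightarrow> E i ! k < 4 \<Longrightarrow> E i ! l < 4 \<Longrightarrow>
      E i ! k \<le> E i ! l"
    and card_markers: "i < m \<Longrightarrow> q < 4 \<Longrightarrow> card {k. k < length (E i) \<and> E i ! k = q} = 2 ^ i"
begin

section \<open>Vertices, adjacency and colours of the subdivision\<close>

text \<open>Edge and position are packed into one number so that \<open>'a + nat\<close> can hold
  all vertices.\<close>

definition dv :: "nat \<Rightarrow> nat \<Rightarrow> 'a + nat" where
  "dv i k = Inr (prod_encode (i, k))"

text \<open>Positions on the whole path of edge \<open>i\<close>, endpoints included; hence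
  \<open>dv i k\<close> sits at position \<open>Suc k\<close>.\<close>

definition node :: "nat \<Rightarrow> nat \<Rightarrow> 'a + nat" where
  "node i k = (if k = 0 then Inl (u i) else if k = Suc (length (E i)) then Inl (v i) else dv i (k - 1))"

definition adj :: "'a + nat \<Rightarrow> 'a + nat \<Rightarrow> bool" where
  "adj x y \<longleftrightarrow> (\<exists>i<m. \<exists>k\<le>length (E i).
     x = node i k \<and> y = node i (Suc k) \<or> y = node i k \<and> x = node i (Suc k))"

definition col :: "'a + nat \<Rightarrow> nat" where
  "col x = (case x of Inl _ \<Rightarrow> 4 | Inr n \<Rightarrow> (case prod_decode n of (i, k) \<Rightarrow> E i ! k))"

lemma dv_eq_iff [simp]: "dv i k = dv j l \<longleftrightarrow> i = j \<and> k = l"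
  by (simp add: dv_def)

lemma dv_neq_Inl [simp]: "dv i k \<noteq> Inl a" "Inl a \<noteq> dv i k"
  by (simp_all add: dv_def)

lemma col_simps [simp]: "col (Inl a) = 4" "col (dv i k) = E i ! k"
  by (simp_all add: col_def dv_def)

lemma node_simps [simp]:
  "node i 0 = Inl (u i)" "k < length (E i) \<Longrightarrow> node i (Suc k) = dv i k"
  "node i (Suc (length (E i))) = Inl (v i)"
  by (simp_all add: node_def)

lemma node_eq_dvD: "node i k = dv j l \<Longrightarrow> i = j \<and> k = Suc l"
  by (auto simp: node_def split: if_splits)

lemma length_E: "i < m \<Longrightarrow> length (E i) > 0"
  using card_markers[of i 0] by (cases "E i") auto

lemma adj_sym: "adj x y \<Longrightarrow> adj y x"
  by (auto simp: adj_def)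

lemma adj_dvD: "adj (dv i k) y \<Longrightarrow> y = node i k \<or> y = node i (Suc (Suc k))"
  unfolding adj_def by (metis node_eq_dvD nat.inject)

definition all_verts where
  "all_verts = range Inl \<union> {dv i k | i k. i < m \<and> k < length (E i)}"

lemma node_in_all_verts: "i < m \<Longrightarrow> k \<le> Suc (length (E i)) \<Longrightarrow> node i k \<in> all_verts"
  by (auto simp: node_def all_verts_def)

lemma adj_all_verts: "adj x y \<Longrightarrow> x \<in> all_verts \<and> y \<in> all_verts"
  by (auto simp: adj_def intro!: node_in_all_verts)

lemma adj_dv_dvD: "adj (dv i k) (dv j l) \<Longrightarrow> i = j \<and> (l = Suc k \<or> k = Suc l)"
  by (auto dest!: adj_dvD dest: node_eq_dvD[OF sym])

text \<open>Adjacent division vertices belong to the same edge and have neighbouring positions, so a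
  path without original vertices runs through an interval of one edge. It reads a factor of
  \<open>E i\<close> or the reversal of one.\<close>

lemma no_anagram_on_edge:
  assumes p: "distinct p" "successively adj p" "set p \<subseteq> {dv i k | i k. i < m \<and> k < length (E i)}"
  shows "\<not> anagram (map col p)"
proof
  assume ana: "anagram (map col p)"
  then have "p \<noteq> []"
    by (auto simp: anagram_def)
  have "\<exists>i ks. i < m \<and> p = map (dv i) ks \<and> set ks \<subseteq> {..<length (E i)}"
    using \<open>p \<noteq> []\<close> p(2,3)
  proof (induction p rule: list_nonempty_induct)
    case (single x)
    then obtain i k where "x = dv i k" "i < m" "k < length (E i)"
      by auto
    then show ?case
      by (intro exI[of _ i] exI[of _ "[k]"]) auto
  next
    case (cons x p)
    then obtain i ks where ks: "i < m" "p = map (dv i) ks" "set ks \<subseteq> {..<length (E i)}"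
      by (auto simp: successively_Cons)
    obtain j k where x: "x = dv j k" "k < length (E j)"
      using cons.prems by auto
    have "adj (dv j k) (dv i (hd ks))"
      using cons x ks by (cases ks) (auto simp: successively_Cons)
    then have "j = i"
      using adj_dv_dvD by blast
    then show ?case
      using x ks by (intro exI[of _ i] exI[of _ "k # ks"]) auto
  qed
  then obtain i ks where i: "i < m" "p = map (dv i) ks" "set ks \<subseteq> {..<length (E i)}"
    by blast
  have "distinct ks"
    using p(1) i(2) by (simp add: distinct_map)
  moreover have "successively (\<lambda>a b. b = Suc a \<or> a = Suc b) ks"
    using p(2) unfolding i(2) successively_map
    by (rule successively_mono) (auto dest: adj_dv_dvD)
  ultimately obtain a b where ab: "ks = [a..<b] \<or> ks = rev [a..<b]"
    by (rule distinct_unit_steps)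
  have "ks \<noteq> []"
    using \<open>p \<noteq> []\<close> i by simp
  then have "a < b"
    using ab by (metis rev.simps(1) upt_rec)
  then have "b - 1 \<in> set ks"
    using ab by auto
  then have "b \<le> length (E i)"
    using i(3) by fastforce
  have "map ((!) (E i)) [a..<b] = take (b - a) (drop a (E i))"
    using \<open>b \<le> length (E i)\<close> by (intro nth_equalityI) auto
  then have "sublist (map ((!) (E i)) [a..<b]) (E i)"
    by (metis sublist_drop sublist_order.order_trans sublist_take)
  then have "\<not> anagram (map ((!) (E i)) [a..<b])"
    using anagram_free_E[OF i(1)] by (simp add: anagram_free_def)
  moreover have "map col p = map ((!) (E i)) ks"
    by (simp add: i(2))
  ultimately show False
    using ab ana by (auto simp: rev_map[symmetric] anagram_rev)
qed

text \<open>After deleting the vertices of a marker colour \<open>q\<close>, every component contains at most one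
  vertex of the original graph.\<close>

lemma originals_without_marker:
  assumes q: "q < 4" and p: "successively adj p" "q \<notin> col ` set p"
    and ab: "Inl a \<in> set p" "Inl b \<in> set p"
  shows "a = b"
proof -
  have "\<exists>k. k < length (E i) \<and> E i ! k = q" if "i < m" for i
    using card_markers[OF that q] by (metis (mono_tags, lifting) card.empty empty_Collect_eq
      power_not_zero zero_neq_numeral)
  then obtain \<kappa> where \<kappa>: "\<And>i. i < m \<Longrightarrow> \<kappa> i < length (E i) \<and> E i ! \<kappa> i = q"
    by metis
  \<comment> \<open>\<open>comp\<close> contracts each edge onto its endpoints, divided at the
    vertex \<open>dv i (\<kappa> i)\<close> of colour \<open>q\<close>. It can change only at a step
    involving that vertex, which a path without colour \<open>q\<close> avoids.\<close>
  define comp where "comp x = (case x of Inl a \<Rightarrow> a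
    | Inr n \<Rightarrow> (case prod_decode n of (i, k) \<Rightarrow> if k < \<kappa> i then u i else v i))" for x :: "'a + nat"
  have comp_simps [simp]: "comp (Inl a) = a" "comp (dv i k) = (if k < \<kappa> i then u i else v i)" for a i k
    by (simp_all add: comp_def dv_def)
  have node: "comp (node i k) = comp (node i (Suc k))"
    if i: "i < m" "k \<le> length (E i)" and ne: "col (node i k) \<noteq> q" "col (node i (Suc k)) \<noteq> q" for i k
  proof -
    note \<kappa>i = \<kappa>[OF i(1)]
    consider "k = 0" | j where "k = Suc j" "Suc j < length (E i)" | j where "k = Suc j" "Suc j = length (E i)"
      using i(2) le_neq_implies_less by (cases k) blast+
    then show ?thesis
    proof cases
      case 1
      then have "\<kappa> i \<noteq> 0"
        using ne length_E[OF i(1)] \<kappa>i by (intro notI) auto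
      then show ?thesis
        using 1 length_E[OF i(1)] by simp
    next
      case 2
      then have "\<kappa> i \<noteq> j" "\<kappa> i \<noteq> Suc j"
        using ne \<kappa>i by (intro notI; auto)+
      then show ?thesis
        using 2 by simp
    next
      case 3
      then have node: "node i k = dv i j" "node i (Suc k) = Inl (v i)"
        by (metis lessI node_simps(2), metis node_simps(3))
      then have "\<kappa> i \<noteq> j"
        using ne \<kappa>i by (intro notI) auto
      then have "\<not> j < \<kappa> i"
        using 3 \<kappa>i by linarith
      then show ?thesis
        using node by simp
    qed
  qed
  have adj: "comp x = comp y" if "adj x y" "col x \<noteq> q" "col y \<noteq> q" for x y
    using that node unfolding adj_def by metis
  have "\<exists>c. \<forall>x\<in>set p. comp x = c"
    using p
  proof (induction p)
    case (Cons x p)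
    show ?case
    proof (cases "p = []")
      case False
      with Cons obtain c where c: "\<forall>x\<in>set p. comp x = c"
        by (auto simp: successively_Cons)
      moreover have "comp x = comp (hd p)"
        using Cons.prems False by (intro adj) (auto simp: successively_Cons)
      ultimately show ?thesis
        using False by auto
    qed simp
  qed simp
  then show "a = b"
    using ab comp_simps(1) by metis
qed

text \<open>An inner vertex of the path has two distinct neighbours on it. With only
  \<open>y\<close> and \<open>y'\<close> available, \<open>y\<close> is one of them, and the change
  of label marks the boundary between \<open>W\<close> and \<open>P\<close>. Otherwise
  \<open>x\<close> is an end of the path.\<close>

lemma boundary_or_end:
  assumes p: "distinct (W @ P)" "successively adj (W @ P)" "W \<noteq> []" "P \<noteq> []"
    and x: "x \<in> set (W @ P)" "\<And>z. adj x z \<Longrightarrow> z = y \<or> z = y'"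
    and label: "(x \<in> set W, x \<in> set P) \<noteq> (y \<in> set W, y \<in> set P)"
  shows "{x, y} = {last W, hd P} \<or> x = hd (W @ P) \<and> y \<noteq> (W @ P) ! 1 \<or>
    x = last (W @ P) \<and> y \<noteq> rev (W @ P) ! 1"
proof -
  obtain as bs where split: "W @ P = as @ x # bs"
    using x(1) by (meson split_list)
  have next_y: ?thesis if "bs \<noteq> []" "y = hd bs"
  proof -
    have "W @ P = as @ x # y # tl bs"
      using split that by simp
    from boundary_if_consecutive[OF this p(1) label] show ?thesis
      by simp
  qed
  have prev_y: ?thesis if "as \<noteq> []" "y = last as"
  proof -
    have "W @ P = butlast as @ y # x # bs"
      using split that by simp
    from boundary_if_consecutive[OF this p(1) label[symmetric]] show ?thesis
      by (simp add: insert_commute)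
  qed
  have "as \<noteq> [] \<or> bs \<noteq> []"
    using split p(3,4) by (auto simp: append_eq_Cons_conv)
  then consider "as = []" "bs \<noteq> []" | "as \<noteq> []" "bs = []" | "as \<noteq> []" "bs \<noteq> []"
    by blast
  then show ?thesis
  proof cases
    case 1
    then show ?thesis
      using split next_y by (auto simp: hd_conv_nth)
  next
    case 2
    then show ?thesis
      using split prev_y by (auto simp: last_conv_nth rev_nth)
  next
    case 3
    then have "adj (last as) x" "adj x (hd bs)"
      using p(2) unfolding split by (auto simp: successively_append_iff successively_Cons)
    then have "last as = y \<or> last as = y'" "hd bs = y \<or> hd bs = y'"
      using x(2) adj_sym by blast+
    moreover have "last as \<noteq> hd bs"
      using p(1) last_in_set[OF 3(1)] hd_in_set[OF 3(2)] unfolding split by auto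
    ultimately show ?thesis
      using next_y prev_y 3 by auto
  qed
qed

text \<open>Meant for an end \<open>x\<close> of a path and its neighbour \<open>z\<close> on the
  path: the path stops at \<open>x\<close> without crossing between \<open>dv i k\<close> and
  \<open>dv i (Suc k)\<close>.\<close>

definition end_break :: "'a + nat \<Rightarrow> 'a + nat \<Rightarrow> nat \<Rightarrow> nat \<Rightarrow> bool" where
  "end_break x z i k \<longleftrightarrow> x = dv i k \<and> z \<noteq> dv i (Suc k) \<or> x = dv i (Suc k) \<and> z \<noteq> dv i k"

text \<open>A division vertex \<open>x\<close> has two sides, one of which is occupied by
  \<open>z\<close>; only the other is left for a break.\<close>

lemma end_break_unique:
  assumes "adj x z" "end_break x z i k" "end_break x z j l"
    and "Suc k < length (E i)" "Suc l < length (E j)"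
  shows "i = j \<and> k = l"
proof -
  have *: False if "x = dv i (Suc l)" "z \<noteq> dv i l" "z \<noteq> dv i (Suc (Suc l))" "Suc (Suc l) < length (E i)" for i l
    using adj_dvD[of i "Suc l" z] that assms(1) by simp
  show ?thesis
    using assms(2-5) *[of i k] *[of i l] unfolding end_break_def by auto
qed

text \<open>Along the subdivided edges, membership in \<open>W\<close> and \<open>P\<close> changes only at the boundary between
  \<open>W\<close> and \<open>P\<close> and at the two ends of the path. The ranges of the four markers on an edge are disjoint,
  so these three changes cannot affect all of the markers.\<close>

lemma ex_unbroken_marker:
  fixes W P :: "('a + nat) list"
  defines "lab x \<equiv> (x \<in> set W, x \<in> set P)"
  assumes p: "distinct (W @ P)" "successively adj (W @ P)" "W \<noteq> []" "P \<noteq> []"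
  obtains q where "q < 4" "\<And>i k l. i < m \<Longrightarrow> k < length (E i) \<Longrightarrow> l < length (E i) \<Longrightarrow>
    E i ! k = q \<Longrightarrow> E i ! l = q \<Longrightarrow> lab (dv i k) = lab (dv i l)"
proof (rule ccontr)
  note contra = that
  assume "\<not> thesis"
  \<comment> \<open>The sources of change are the middle (\<open>t = 0\<close>), the start
    (\<open>t = 1\<close>) and the end of the path; \<open>T t i j\<close> locates one of them
    between \<open>dv i j\<close> and \<open>dv i (Suc j)\<close>.\<close>
  define T where "T t i j \<longleftrightarrow> (if t = 0 then {dv i j, dv i (Suc j)} = {last W, hd P}
    else if t = 1 then end_break (hd (W @ P)) ((W @ P) ! 1) i j
    else end_break (last (W @ P)) (rev (W @ P) ! 1) i j)" for t :: nat and i j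
  have T_simps: "T 0 i j \<longleftrightarrow> {dv i j, dv i (Suc j)} = {last W, hd P}"
    "T 1 i j \<longleftrightarrow> end_break (hd (W @ P)) ((W @ P) ! 1) i j"
    "T 2 i j \<longleftrightarrow> end_break (last (W @ P)) (rev (W @ P) ! 1) i j" for i j
    by (simp_all add: T_def)
  have len: "length (W @ P) \<ge> 2"
    using p(3,4) by (cases W; cases P) auto
  have "adj (hd p) (p ! 1)" if "length p \<ge> 2" "successively adj p" for p
    using that by (cases p; cases "tl p") auto
  from this[of "W @ P"] this[of "rev (W @ P)"] have ends:
    "adj (hd (W @ P)) ((W @ P) ! 1)" "adj (last (W @ P)) (rev (W @ P) ! 1)"
    using len p(2) adj_sym by (simp_all only: successively_rev hd_rev length_rev) 
       (auto intro: successively_mono)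
  have T_unique: "i = i' \<and> j = j'"
    if "T t i j" "T t i' j'" "Suc j < length (E i)" "Suc j' < length (E i')" for t i j i' j'
  proof (cases "t = 0")
    case True
    then have "{dv i j, dv i (Suc j)} = {dv i' j', dv i' (Suc j')}"
      using that by (simp add: T_def)
    then show ?thesis
      by (auto simp: doubleton_eq_iff)
  next
    case False
    then show ?thesis
      using that end_break_unique[OF ends(1), of i j i' j'] end_break_unique[OF ends(2), of i j i' j']
      by (simp add: T_def split: if_splits)
  qed
  \<comment> \<open>The step from position \<open>j\<close> to \<open>Suc j\<close> separates two
    vertices of marker \<open>q\<close>. As markers increase along the edge, this happens for at
    most one marker per step.\<close>
  define crosses where "crosses q i j \<longleftrightarrow> i < m \<and> Suc j < length (E i) \<and>
    (\<exists>k l. k \<le> j \<and> j < l \<and> l < length (E i) \<and> E i ! k = q \<and> E i ! l = q)" for q i j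
  have crosses_le: "q \<le> q'" if "crosses q i j" "crosses q' i j" "q < 4" "q' < 4" for q q' i j
  proof -
    from that obtain k l where "k \<le> j" "j < l" "l < length (E i)" "E i ! k = q" "E i ! l = q'" "i < m"
      by (auto simp: crosses_def)
    then show ?thesis
      using markers_sorted[of i k l] that by simp
  qed
  have "\<exists>t<3. \<exists>i j. crosses q i j \<and> T t i j" if "q < 4" for q
  proof -
    from that contra[of q] \<open>\<not> thesis\<close> obtain i k l where kl: "i < m" "k < length (E i)" "l < length (E i)"
        "E i ! k = q" "E i ! l = q" "lab (dv i k) \<noteq> lab (dv i l)" 
      by metis
    then have "k \<noteq> l" by auto
    define a b where "a = min k l" and "b = max k l"
    have ab: "a < b" "b < length (E i)" "E i ! a = q" "E i ! b = q" "lab (dv i a) \<noteq> lab (dv i b)"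
      using kl \<open>k \<noteq> l\<close> by (auto simp: a_def b_def min_def max_def)
    obtain j where j: "a \<le> j" "j < b" "lab (dv i j) \<noteq> lab (dv i (Suc j))"
      using ex_change_between[of a b "\<lambda>k. lab (dv i k)"] ab by auto
    have "crosses q i j"
      unfolding crosses_def using kl(1) ab j by auto
    moreover have "T 0 i j \<or> T 1 i j \<or> T 2 i j"
    proof -
      have nbrs: "\<And>z. adj (dv i j) z \<Longrightarrow> z = dv i (Suc j) \<or> z = node i j"
        "\<And>z. adj (dv i (Suc j)) z \<Longrightarrow> z = dv i j \<or> z = node i (Suc (Suc (Suc j)))"
        using ab j adj_dvD by (metis less_trans_Suc node_simps(2) Suc_lessD Suc_lessI)+
      consider "dv i j \<in> set (W @ P)" | "dv i (Suc j) \<in> set (W @ P)"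
        using j(3) by (auto simp: lab_def)
      then show ?thesis
      proof cases
        case 1
        from boundary_or_end[OF p this nbrs(1) j(3)[unfolded lab_def]] show ?thesis
          unfolding T_simps end_break_def by metis
      next
        case 2
        from boundary_or_end[OF p this nbrs(2) j(3)[symmetric, unfolded lab_def]] show ?thesis
          unfolding T_simps end_break_def insert_commute[of "dv i (Suc j)"] by metis
      qed
    qed
    moreover have "(0::nat) < 3" "(1::nat) < 3" "(2::nat) < 3" by simp_all
    ultimately show ?thesis by blast
  qed
  then obtain \<tau> \<iota> \<gamma> where \<tau>: "\<And>q. q < 4 \<Longrightarrow> \<tau> q < 3 \<and> crosses q (\<iota> q) (\<gamma> q) \<and> T (\<tau> q) (\<iota> q) (\<gamma> q)"
    by metis
  \<comment> \<open>Two markers assigned to the same change would be crossed at the same step and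
    hence coincide; but four markers do not fit into three changes.\<close>
  have "inj_on \<tau> {..<4}"
  proof (rule inj_onI)
    fix q q' assume q: "q \<in> {..<4}" "q' \<in> {..<4}" "\<tau> q = \<tau> q'"
    then have "\<iota> q = \<iota> q' \<and> \<gamma> q = \<gamma> q'"
      using \<tau>[of q] \<tau>[of q'] by (intro T_unique[of "\<tau> q"]) (auto simp: crosses_def)
    with \<tau>[of q] \<tau>[of q'] q have "crosses q (\<iota> q) (\<gamma> q)" "crosses q' (\<iota> q) (\<gamma> q)" "q < 4" "q' < 4"
      by auto
    then show "q = q'"
      by (intro antisym crosses_le)
  qed
  moreover have "\<tau> ` {..<4} \<subseteq> {..<3}"
    using \<tau> by auto
  ultimately show False
    using card_inj_on_le[of \<tau> "{..<4}" "{..<3}"] by simp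
qed

text \<open>The length bound excludes one-entry lists, for which \<open>successively adj\<close>
  says nothing about the entry.\<close>

lemma adj_path_verts:
  assumes "successively adj p" "length p \<ge> 2"
  shows "set p \<subseteq> all_verts"
proof
  fix x assume "x \<in> set p"
  then obtain as bs where "p = as @ x # bs"
    by (meson split_list)
  then have "as \<noteq> [] \<and> adj (last as) x \<or> bs \<noteq> [] \<and> adj x (hd bs)"
    using assms by (cases as rule: rev_cases) (auto simp: successively_append_iff successively_Cons)
  then show "x \<in> all_verts"
    using adj_all_verts by blast
qed

theorem no_anagram:
  assumes p: "distinct p" "successively adj p"
  shows "\<not> anagram (map col p)"
proof
  assume ana: "anagram (map col p)"
  then obtain W P where WP: "p = W @ P" "W \<noteq> []" "P \<noteq> []" "mset (map col W) = mset (map col P)"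
    by (rule anagram_mapD)
  have dist: "distinct W" "distinct P" "set W \<inter> set P = {}"
    using p(1) WP(1) by auto
  have "length p \<ge> 2"
    using WP by (cases W; cases P) auto
  then have verts: "set p \<subseteq> all_verts"
    using p(2) adj_path_verts by blast
  have same_card: "card {x \<in> set W. col x = c} = card {x \<in> set P. col x = c}" for c
    using count_map_eq_card[OF dist(1), of col c] count_map_eq_card[OF dist(2), of col c] WP(4) by simp
  obtain q where q: "q < 4" and unbroken: "\<And>i k l. i < m \<Longrightarrow> k < length (E i) \<Longrightarrow> l < length (E i) \<Longrightarrow>
      E i ! k = q \<Longrightarrow> E i ! l = q \<Longrightarrow>
      (dv i k \<in> set W, dv i k \<in> set P) = (dv i l \<in> set W, dv i l \<in> set P)"
    using ex_unbroken_marker[of W P] p WP by metis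
  define D where "D i = dv i ` {k. k < length (E i) \<and> E i ! k = q}" for i
  have card_D: "card (D i) = 2 ^ i" if "i < m" for i
    unfolding D_def using card_markers[OF that q] by (subst card_image) (auto simp: inj_on_def)
  define I where "I X = {i. i < m \<and> D i \<inter> X \<noteq> {}}" for X
  have fin: "finite (I X)" for X
    by (simp add: I_def)
  \<comment> \<open>By the choice of \<open>q\<close>, a set \<open>D i\<close> that meets
    \<open>W\<close> or \<open>P\<close> lies inside it, so only whole sets \<open>D i\<close>
    occur.\<close>
  have decomp: "{x \<in> X. col x = q} = (\<Union>i\<in>I X. D i)" if X: "X = set W \<or> X = set P" for X
  proof (intro equalityI subsetI)
    fix x assume x: "x \<in> {x \<in> X. col x = q}"
    then have "x \<in> all_verts"
      using X verts WP(1) by auto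
    with x q obtain i k where ik: "x = dv i k" "i < m" "k < length (E i)"
      by (auto simp: all_verts_def)
    with x have "x \<in> D i"
      by (auto simp: D_def)
    then show "x \<in> (\<Union>i\<in>I X. D i)"
      using x ik by (auto simp: I_def)
  next
    fix x assume "x \<in> (\<Union>i\<in>I X. D i)"
    then obtain i where i: "i < m" "x \<in> D i" "D i \<inter> X \<noteq> {}"
      by (auto simp: I_def)
    then obtain k l where "x = dv i k" "k < length (E i)" "E i ! k = q"
        "dv i l \<in> X" "l < length (E i)" "E i ! l = q"
      by (auto simp: D_def)
    then show "x \<in> {x \<in> X. col x = q}"
      using unbroken[OF i(1), of k l] X by auto
  qed
  have card: "card {x \<in> X. col x = q} = (\<Sum>i\<in>I X. 2 ^ i)" if X: "X = set W \<or> X = set P" for X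
  proof -
    have "card (\<Union>i\<in>I X. D i) = (\<Sum>i\<in>I X. card (D i))"
      by (rule card_UN_disjoint) (auto simp: fin D_def)
    then show ?thesis
      using decomp[OF X] card_D by (simp add: I_def)
  qed
  \<comment> \<open>Equal sizes mean equal sums of distinct powers of two, and binary expansions are
    unique.\<close>
  have "I (set W) = I (set P)"
    using same_card[of q] card sum_power2_eq_iff[OF fin fin] by simp
  then have "{x \<in> set W. col x = q} = {x \<in> set P. col x = q}"
    using decomp[of "set W"] decomp[of "set P"] by simp
  \<comment> \<open>\<open>W\<close> and \<open>P\<close> are disjoint, so their equal
    \<open>q\<close>-coloured parts are empty.\<close>
  then have "q \<notin> col ` set p"
    using dist(3) unfolding WP(1) by auto
  then have orig: "a = b" if "Inl a \<in> set p" "Inl b \<in> set p" for a b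
    using originals_without_marker[OF q p(2)] that by blast
  have col_4: "\<exists>a. x = Inl a" if "x \<in> set p" "col x = 4" for x
    using that verts not_4 by (auto simp: all_verts_def in_set_conv_nth subset_iff)
  \<comment> \<open>An original vertex in one half would force a second one in the other
    half.\<close>
  have "4 \<notin> col ` set p"
  proof
    assume "4 \<in> col ` set p"
    then have "{x \<in> set W. col x = 4} \<noteq> {} \<or> {x \<in> set P. col x = 4} \<noteq> {}"
      unfolding WP(1) by force
    then have "card {x \<in> set W. col x = 4} > 0 \<or> card {x \<in> set P. col x = 4} > 0"
      unfolding card_gt_0_iff by simp
    then have "card {x \<in> set W. col x = 4} > 0" "card {x \<in> set P. col x = 4} > 0"
      using same_card[of 4] by simp_all
    then obtain x y where "x \<in> set W" "col x = 4" "y \<in> set P" "col y = 4"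
      unfolding card_gt_0_iff by blast
    then show False
      using col_4[of x] col_4[of y] orig WP(1) dist(3) by auto
  qed
  then have "set p \<subseteq> {dv i k | i k. i < m \<and> k < length (E i)}"
    using verts unfolding all_verts_def by force
  then show False
    using no_anagram_on_edge p ana by blast
qed

end

section \<open>The subdivision\<close>

lemma set_vwalk_arcs_subset_iff: "set (vwalk_arcs p) \<subseteq> {(x, y). R x y} \<longleftrightarrow> successively R p"
  by (induction p rule: vwalk_arcs.induct) auto

lemma set_vwalk_arcs_nth: "set (vwalk_arcs p) = {(p ! k, p ! Suc k) | k. Suc k < length p}"
proof (induction p rule: vwalk_arcs.induct)
  case (3 x y xs)
  have "{((x # y # xs) ! k, (x # y # xs) ! Suc k) | k. Suc k < length (x # y # xs)} =
      insert (x, y) {((y # xs) ! k, (y # xs) ! Suc k) | k. Suc k < length (y # xs)}"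
    (is "?A = insert _ ?B")
  proof (intro equalityI subsetI)
    fix a assume "a \<in> ?A"
    then obtain k where "a = ((x # y # xs) ! k, (x # y # xs) ! Suc k)" "Suc k < length (x # y # xs)"
      by blast
    then show "a \<in> insert (x, y) ?B"
      by (cases k) auto
  next
    fix a assume "a \<in> insert (x, y) ?B"
    then consider "a = (x, y)" | k where "a = ((y # xs) ! k, (y # xs) ! Suc k)" "Suc k < length (y # xs)"
      by blast
    then show "a \<in> ?A"
    proof cases
      case 1
      then show ?thesis by (intro CollectI exI[of _ 0]) simp
    next
      case 2
      then show ?thesis by (intro CollectI exI[of _ "Suc k"]) simp
    qed
  qed
  with 3 show ?case by simp
qed auto

lemma set_vwalk_arcs_rev: "set (vwalk_arcs (rev p)) = (set (vwalk_arcs p))\<inverse>"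
proof (induction p rule: vwalk_arcs.induct)
  case (3 x y xs)
  have "vwalk_arcs (rev (x # y # xs)) = vwalk_arcs (rev (y # xs)) @ [(y, x)]"
    using vwalk_arcs_append[of "rev (y # xs)" "[x]"] by simp
  with 3 show ?case by auto
qed auto

lemma internal_verts_rev: "internal_verts (rev p) = rev (internal_verts p)"
proof (cases p)
  case (Cons x q)
  then show ?thesis
    by (cases q rule: rev_cases) (auto simp: internal_verts_def butlast_append)
qed (simp add: internal_verts_def)

context subdivision_colouring
begin

definition edge_path :: "nat \<Rightarrow> ('a + nat) list" where
  "edge_path i = Inl (u i) # map (dv i) [0..<length (E i)] @ [Inl (v i)]"

lemma hd_last_edge_path [simp]: "hd (edge_path i) = Inl (u i)" "last (edge_path i) = Inl (v i)"
  by (simp_all add: edge_path_def)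

lemma internal_verts_edge_path: "internal_verts (edge_path i) = map (dv i) [0..<length (E i)]"
  by (simp add: edge_path_def internal_verts_def butlast_append)

lemma set_edge_path: "set (edge_path i) = {Inl (u i), Inl (v i)} \<union> dv i ` {..<length (E i)}"
  by (auto simp: edge_path_def)

lemma distinct_edge_path: "u i \<noteq> v i \<Longrightarrow> distinct (edge_path i)"
  by (auto simp: edge_path_def distinct_map inj_on_def)

lemma length_edge_path [simp]: "length (edge_path i) = length (E i) + 2"
  by (simp add: edge_path_def)

lemma nth_edge_path: "k \<le> Suc (length (E i)) \<Longrightarrow> edge_path i ! k = node i k"
  by (auto simp: edge_path_def node_def nth_append nth_Cons')

lemma set_vwalk_arcs_edge_path:
  "set (vwalk_arcs (edge_path i)) = {(node i k, node i (Suc k)) | k. k \<le> length (E i)}"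
  unfolding set_vwalk_arcs_nth by (simp add: nth_edge_path less_Suc_eq_le cong: rev_conj_cong)

lemma adj_iff: "adj x y \<longleftrightarrow> (\<exists>i<m. (x, y) \<in> set (vwalk_arcs (edge_path i)) \<union> set (vwalk_arcs (rev (edge_path i))))"
  by (auto simp: adj_def set_vwalk_arcs_rev set_vwalk_arcs_edge_path)

end

section \<open>Assembling the subdivision of a given graph\<close>

theorem theorem5:
  fixes G :: "'a pair_pre_digraph"
  assumes "pair_graph G"
  shows "\<exists>S :: ('a + nat) pair_pre_digraph.
           le_subdivision (3 * 2 ^ (2 * card (uedges G) - 1)) G S \<and> \<phi> S \<le> 14"
proof -
  interpret G: pair_graph G by fact
  define m where "m = card (uedges G)"
  have "finite (uedges G)"
    using G.pair_finite_arcs by (simp add: uedges_def)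
  then obtain e where e: "bij_betw e {..<m} (uedges G)"
    unfolding m_def using ex_bij_betw_nat_finite by (metis atLeast0LessThan)
  have "\<exists>x y. (x, y) \<in> parcs G \<and> e i = {x, y}" if "i < m" for i
    using bij_betwE[OF e] that by (fastforce simp: uedges_def)
  \<comment> \<open>This fixes an arbitrary orientation of every edge.\<close>
  then obtain u v where uv: "\<And>i. i < m \<Longrightarrow> (u i, v i) \<in> parcs G \<and> e i = {u i, v i}"
    by metis
  have sym: "(y, x) \<in> parcs G" if "(x, y) \<in> parcs G" for x y
    using that G.pair_sym_arcs by (auto simp: symmetric_def dest: symD)
  have loopfree: "u i \<noteq> v i" if "i < m" for i
    using G.no_loops' uv that by blast
  define word where "word i w \<longleftrightarrow> anagram_free w \<and> set w \<subseteq> {..<13} - {4} \<and>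
      length w \<le> 3 * 2 ^ (2 * m - 1) \<and>
      (\<forall>k l. k < l \<longrightarrow> l < length w \<longrightarrow> w ! k < 4 \<longrightarrow> w ! l < 4 \<longrightarrow> w ! k \<le> w ! l) \<and>
      (\<forall>q<4. card {k. k < length w \<and> w ! k = q} = 2 ^ i)" for i and w :: "nat list"
  have "\<exists>w. word i w" if "i < m" for i
    unfolding word_def by (rule ex_edge_word[OF that], rule exI) (intro conjI allI impI)
  then obtain E where E: "\<And>i. i < m \<Longrightarrow> word i (E i)"
    by metis
  have E_less: "E i ! k < 13" if "i < m" "k < length (E i)" for i k
    using E[OF that(1)] nth_mem[OF that(2)] by (auto simp: word_def)
  have length_le: "length (E i) \<le> 3 * 2 ^ (2 * m - 1)" if "i < m" for i
    using E[OF that] by (simp add: word_def)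
  interpret subdivision_colouring m u v E
  proof
    fix i assume "i < m"
    from E[OF this, unfolded word_def] show "anagram_free (E i)" "4 \<notin> set (E i)"
      "\<And>k l. k < l \<Longrightarrow> l < length (E i) \<Longrightarrow> E i ! k < 4 \<Longrightarrow> E i ! l < 4 \<Longrightarrow> E i ! k \<le> E i ! l"
      "\<And>q. q < 4 \<Longrightarrow> card {k. k < length (E i) \<and> E i ! k = q} = 2 ^ i"
      by auto
  qed
  define idx where "idx x y = inv_into {..<m} e {x, y}" for x y
  \<comment> \<open>Arcs against the chosen orientation get the reversed path;
    \<open>u i \<noteq> v i\<close> makes the test on the first endpoint decisive.\<close>
  define P where "P = (\<lambda>(x, y). if x = u (idx x y) then edge_path (idx x y) else rev (edge_path (idx x y)))"
  have idx_uv: "idx (u i) (v i) = i" "idx (v i) (u i) = i" if "i < m" for i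
    using e uv[OF that] that unfolding idx_def bij_betw_def
    by (metis inv_into_f_f insert_commute lessThan_iff)+
  have P_uv: "P (u i, v i) = edge_path i" "P (v i, u i) = rev (edge_path i)" if "i < m" for i
    using idx_uv[OF that] loopfree[OF that] by (auto simp: P_def)
  have arcs: "\<exists>i<m. (x, y) = (u i, v i) \<or> (x, y) = (v i, u i)" if "(x, y) \<in> parcs G" for x y
  proof -
    from that have "{x, y} \<in> e ` {..<m}"
      using e by (force simp: bij_betw_def uedges_def)
    then obtain i where "i < m" "{x, y} = {u i, v i}"
      using uv by auto
    then show ?thesis
      by (auto simp: doubleton_eq_iff)
  qed
  have arcs_eq: "parcs G = (\<Union>i<m. {(u i, v i), (v i, u i)})"
    using arcs uv sym by fastforce
  define S where "S = \<lparr>pverts = Inl ` pverts G \<union> (\<Union>i<m. dv i ` {..<length (E i)}),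
    parcs = {(x, y). adj x y}\<rparr>"
  have uv_verts: "u i \<in> pverts G" "v i \<in> pverts G" if "i < m" for i
    using uv[OF that] G.in_arcsD1 G.in_arcsD2 by blast+
  have pverts_S: "pverts S = Inl ` pverts G \<union> (\<Union>a\<in>parcs G. set (P a))"
    unfolding arcs_eq using uv_verts by (auto simp: S_def P_uv set_edge_path)
  have parcs_S: "parcs S = (\<Union>a\<in>parcs G. set (vwalk_arcs (P a)))"
    unfolding arcs_eq by (auto simp: S_def adj_iff P_uv)
  have adj_S: "x \<in> pverts S \<and> y \<in> pverts S \<and> x \<noteq> y" if "adj x y" for x y
  proof -
    from that obtain i where i: "i < m"
        "(x, y) \<in> set (vwalk_arcs (edge_path i)) \<or> (y, x) \<in> set (vwalk_arcs (edge_path i))"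
      by (auto simp: adj_iff set_vwalk_arcs_rev)
    then obtain k where k: "Suc k < length (edge_path i)"
        "x = edge_path i ! k \<and> y = edge_path i ! Suc k \<or> y = edge_path i ! k \<and> x = edge_path i ! Suc k"
      unfolding set_vwalk_arcs_nth by blast
    have "edge_path i ! k \<noteq> edge_path i ! Suc k"
      using distinct_edge_path[OF loopfree[OF i(1)]] Suc_lessD[OF k(1)] k(1)
      by (metis n_not_Suc_n nth_eq_iff_index_eq)
    then have "x \<noteq> y"
      using k(2) by blast
    moreover have "x \<in> set (edge_path i)" "y \<in> set (edge_path i)"
      using k(2) nth_mem[OF k(1)] nth_mem[OF Suc_lessD[OF k(1)]] by auto
    ultimately show ?thesis
      using i(1) uv_verts by (auto simp: S_def set_edge_path)
  qed
  have fin: "finite (pverts S)"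
    using G.pair_finite_verts by (simp add: S_def)
  have parcs_adj: "parcs S = {(x, y). adj x y}"
    by (simp add: S_def)
  have "pair_graph S"
  proof unfold_locales
    show "finite (parcs S)"
      by (rule finite_subset[of _ "pverts S \<times> pverts S"]) (use fin adj_S in \<open>auto simp: parcs_adj\<close>)
    show "symmetric (with_proj S)"
      using adj_sym by (auto simp: parcs_adj symmetric_def sym_def)
  qed (use adj_S fin in \<open>auto simp: parcs_adj\<close>)
  have path: "vpath (P a) (with_proj S)" if a: "a \<in> parcs G" for a
  proof -
    obtain i where i: "i < m" "a = (u i, v i) \<or> a = (v i, u i)"
      using arcs a by (cases a) blast
    then have "P a = edge_path i \<or> P a = rev (edge_path i)"
      using P_uv[OF i(1)] by auto
    then have "distinct (P a)" "P a \<noteq> []"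
      using distinct_edge_path[OF loopfree[OF i(1)]] by (auto simp: edge_path_def)
    moreover have "set (P a) \<subseteq> pverts S" "set (vwalk_arcs (P a)) \<subseteq> parcs S"
      using a pverts_S parcs_S by blast+
    ultimately show ?thesis
      by (auto simp: vpath_def vwalk_def)
  qed
  have internal: "set (internal_verts (P a)) = dv i ` {..<length (E i)}"
      "length (internal_verts (P a)) = length (E i)"
    if "i < m" "a = (u i, v i) \<or> a = (v i, u i)" for a i
    using that(2) P_uv[OF that(1)] by (auto simp: internal_verts_rev internal_verts_edge_path)
  have "subdivision_by G S Inl P"
    unfolding subdivision_by_def
  proof (intro conjI ballI)
    fix a assume a: "a \<in> parcs G"
    obtain x y where xy: "a = (x, y)" by fastforce
    obtain i where i: "i < m" "a = (u i, v i) \<or> a = (v i, u i)"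
      using arcs a xy by blast
    have "P (y, x) = rev (P (x, y)) \<and> hd (P (x, y)) = Inl x \<and> last (P (x, y)) = Inl y"
      using i xy P_uv[OF i(1)] by (auto simp: hd_rev last_rev)
    moreover have "set (internal_verts (P (x, y))) \<inter> Inl ` pverts G = {}"
      using internal[OF i] xy by auto
    ultimately show "case a of (u, v) \<Rightarrow> vpath (P (u, v)) (with_proj S) \<and>
        hd (P (u, v)) = Inl u \<and> last (P (u, v)) = Inl v \<and> P (v, u) = rev (P (u, v)) \<and>
        set (internal_verts (P (u, v))) \<inter> Inl ` pverts G = {}"
      using path[OF a] xy by simp
    show "case a of (u, v) \<Rightarrow> \<forall>(x, y)\<in>parcs G. {u, v} \<noteq> {x, y} \<longrightarrow>
        set (internal_verts (P (u, v))) \<inter> set (internal_verts (P (x, y))) = {}"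
    proof (clarsimp simp: xy)
      fix x' y' assume b: "(x', y') \<in> parcs G" "{x, y} \<noteq> {x', y'}"
      obtain j where j: "j < m" "(x', y') = (u j, v j) \<or> (x', y') = (v j, u j)"
        using arcs[OF b(1)] by blast
      have "i \<noteq> j"
        using b(2) i(2) j(2) xy by auto
      then show "set (internal_verts (P (x, y))) \<inter> set (internal_verts (P (x', y'))) = {}"
        using internal(1)[OF i] internal(1)[OF j] xy by auto
    qed
  qed (use \<open>pair_graph S\<close> pverts_S parcs_S in \<open>auto simp: inj_on_def\<close>)
  moreover have "length (internal_verts (P a)) \<le> 3 * 2 ^ (2 * card (uedges G) - 1)" if a: "a \<in> parcs G" for a
  proof -
    obtain i where "i < m" "a = (u i, v i) \<or> a = (v i, u i)"
      using arcs a by (cases a) blast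
    then show ?thesis
      using internal(2) length_le by (simp add: m_def)
  qed
  ultimately have "le_subdivision (3 * 2 ^ (2 * card (uedges G) - 1)) G S"
    unfolding le_subdivision_def by blast
  moreover have "\<phi> S \<le> 14"
    unfolding anagram_free_chromatic_number_def
  proof (rule Least_le, intro exI conjI)
    \<comment> \<open>Four markers, the colour 4 and eight letters make 13 colours, numbered 0 to
      12.\<close>
    show "col ` pverts S \<subseteq> {..<14}"
      using E_less by (auto simp: S_def less_Suc_eq[of _ 13] intro: less_trans)
    show "anagram_free_colouring S col"
      unfolding anagram_free_colouring_def
    proof (intro allI impI)
      fix p assume "vpath p (with_proj S)"
      then have "distinct p" "successively adj p"
        by (auto simp: vpath_def vwalk_def S_def simp flip: set_vwalk_arcs_subset_iff)
      then show "\<not> anagram (map col p)"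
        by (rule no_anagram)
    qed
  qed
  ultimately show ?thesis
    by blast
qed

end
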